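(* Let $(A,B)\in\{(16,14),(36,30),(72,42),(196,70),(252,114)\}$ and let $N=An+B$ for some nonnegative integer $n$. Then $$\sum_{1\le k<\sqrt{N}}\sigma_0(N-k^2)\equiv 0 \pmod 4,$$ where the sum runs over positive integers $k$ with $k<\sqrt N$.
   Context: For a positive integer $m$, $\sigma_0(m)$ denotes the number of positive divisors of $m$. *)

theory Defs
  imports Complex_Main "HOL-Number_Theory.Cong"
begin

definition sigma0 :: "nat \<Rightarrow> nat" where
  "sigma0 m = card {d. d dvd m}"

end

theory Submission
  imports Defs
begin

text \<open>
  In all cases \<open>N = 2 M\<close> with \<open>M\<close> odd.

  For even \<open>k = 2 t\<close> we have \<open>\<sigma>\<^sub>0(N - k\<^sup>2) = 2 \<sigma>\<^sub>0(M - 2 t\<^sup>2)\<close>, so this part of the sum is governed by the parity of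
  the number of representations \<open>M = s\<^sup>2 + 2 t\<^sup>2\<close>. There are none modulo 8 or 7, or, if \<open>M = 3 u\<close>, they come in pairs.

  The terms with odd \<open>k\<close> count triples \<open>k\<^sup>2 + a b = N\<close>, that is, forms \<open>a x\<^sup>2 + 2 k x y - b y\<^sup>2\<close> on the river of
  Conway's topograph. Such an edge of the river has the even values \<open>a + 2 k - b\<close> and \<open>a - 2 k - b\<close> at its two ends.
  A quadratic character \<open>Q\<close> holds for exactly one of the two (after halving and up to sign); selecting that end, the
  triples correspond two to one to pairs \<open>(e, r)\<close> of an even value \<open>e > 0\<close> with \<open>Q (e / 2)\<close> and a square root \<open>r\<close>
  of \<open>N\<close> modulo \<open>e\<close>. The involution \<open>r \<mapsto> - r\<close> fixes only the classes \<open>r = 0\<close>, \<open>e | N\<close>, so the number of pairs has the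
  parity of the number of divisors \<open>d\<close> of \<open>M\<close> with \<open>Q d\<close>, which is even.
\<close>

subsection \<open>Involutions and even \<open>k\<close>\<close>

text \<open>Elements moved by \<open>f\<close> come in disjoint pairs \<open>{x, f x}\<close>.
  Removing one pair keeps the set closed under \<open>f\<close> and loses no fixed point, so
  induction on the cardinality applies.\<close>

lemma even_card_involution:
  assumes "finite S" and "\<And>x. x \<in> S \<Longrightarrow> f x \<in> S" and "\<And>x. x \<in> S \<Longrightarrow> f (f x) = x"
  shows "even (card S) \<longleftrightarrow> even (card {x \<in> S. f x = x})"
  using assms
proof (induction "card S" arbitrary: S rule: less_induct)
  case less
  show ?case
  proof (cases "\<exists>x\<in>S. f x \<noteq> x")
    case False
    then have "{x \<in> S. f x = x} = S" by auto
    then show ?thesis by simp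
  next
    case True
    then obtain x where x: "x \<in> S" "f x \<noteq> x" by blast
    let ?T = "S - {x, f x}"
    have sub: "{x, f x} \<subseteq> S" using x less.prems by auto
    have c2: "card {x, f x} = 2" using x by simp
    have cS: "card S = card ?T + 2"
      using card_Diff_subset[OF _ sub] card_mono[OF less.prems(1) sub] c2 by simp
    have "f y \<in> ?T" if "y \<in> ?T" for y
      using that x less.prems(2,3) by (metis Diff_iff insert_iff empty_iff)
    then have "even (card ?T) \<longleftrightarrow> even (card {y \<in> ?T. f y = y})"
      by (intro less.hyps) (use cS less.prems in auto)
    moreover have "{y \<in> ?T. f y = y} = {y \<in> S. f y = y}"
      using x less.prems(3)[OF x(1)] by auto
    ultimately show ?thesis using cS by simp
  qed
qed

lemma even_card_fixpoint_free:
  assumes "finite S" and "\<And>x. x \<in> S \<Longrightarrow> f x \<in> S" and "\<And>x. x \<in> S \<Longrightarrow> f (f x) = x"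
    and "\<And>x. x \<in> S \<Longrightarrow> f x \<noteq> x"
  shows "even (card S)"
proof -
  have no_fix: "{x \<in> S. f x = x} = {}" using assms(4) by auto
  show ?thesis using even_card_involution[of S f, OF assms(1-3)] unfolding no_fix by simp
qed

lemma abs_le_power2_int: "\<bar>x\<bar> \<le> x\<^sup>2" for x :: int
proof (cases "x = 0")
  case False
  then have "\<bar>x\<bar> * 1 \<le> \<bar>x\<bar> * \<bar>x\<bar>" by (intro mult_left_mono) auto
  then show ?thesis by (simp add: power2_eq_square)
qed simp

section \<open>Divisor counts and the terms with even \<open>k\<close>\<close>

text \<open>The involution \<open>d \<mapsto> m div d\<close> on the divisors of \<open>m\<close>
  can fix only the square root of \<open>m\<close>.\<close>

lemma even_sigma0_iff:
  assumes "m > 0"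
  shows "even (sigma0 m) \<longleftrightarrow> \<not> (\<exists>s. m = s\<^sup>2)"
proof -
  let ?D = "{d. d dvd m}"
  have fix_iff: "m div d = d \<longleftrightarrow> m = d\<^sup>2" if "d dvd m" for d
    using that assms by (auto simp: power2_eq_square elim!: dvdE)
  have "even (card ?D) \<longleftrightarrow> even (card {d \<in> ?D. m div d = d})"
    using assms by (intro even_card_involution) auto
  also have "{d \<in> ?D. m div d = d} = {d. m = d\<^sup>2}"
    using fix_iff by (auto simp: power2_eq_square)
  also have "even (card {d. m = d\<^sup>2}) \<longleftrightarrow> \<not> (\<exists>s. m = s\<^sup>2)"
  proof (cases "\<exists>s. m = s\<^sup>2")
    case True
    then obtain s where "m = s\<^sup>2" by blast
    then have "{d. m = d\<^sup>2} = {s}" by (auto simp: power2_eq_iff_nonneg)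
    then show ?thesis using True by simp
  qed auto
  finally show ?thesis by (simp add: sigma0_def)
qed

text \<open>A divisor of \<open>2 * m\<close> is either odd, hence a divisor of \<open>m\<close>, or
  twice a divisor of \<open>m\<close>. Oddness of \<open>m\<close> keeps the two families
  disjoint.\<close>

lemma sigma0_double:
  assumes "odd m"
  shows "sigma0 (2 * m) = 2 * sigma0 m"
proof -
  have m: "m > 0" using assms by (cases m) auto
  have "{d. d dvd 2 * m} = {d. d dvd m} \<union> (*) 2 ` {d. d dvd m}"
  proof (intro equalityI subsetI)
    fix d assume d: "d \<in> {d. d dvd 2 * m}"
    show "d \<in> {d. d dvd m} \<union> (*) 2 ` {d. d dvd m}"
    proof (cases "even d")
      case True
      then show ?thesis using d by (auto elim!: evenE)
    next
      case False
      then have "coprime d 2" by simp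
      then show ?thesis using d by (simp add: coprime_dvd_mult_right_iff)
    qed
  qed auto
  moreover have "{d. d dvd m} \<inter> (*) 2 ` {d. d dvd m} = {}"
    using assms by (auto dest: dvd_mult_left)
  moreover have "finite {d. d dvd m}" using m by simp
  moreover have "card ((*) 2 ` {d. d dvd m}) = card {d. d dvd m}"
    by (intro card_image inj_onI) simp
  ultimately show ?thesis by (simp add: sigma0_def card_Un_disjoint)
qed

lemma four_dvd_sum_sigma0_even:
  fixes M N :: nat
  assumes "odd M" and N: "N = 2 * M" and "even (card {t. 0 < t \<and> (\<exists>s. s\<^sup>2 + 2 * t\<^sup>2 = M)})"
  shows "4 dvd (\<Sum>k | 0 < k \<and> k\<^sup>2 < N \<and> even k. sigma0 (N - k\<^sup>2))"
proof -
  let ?T = "{t. 0 < t \<and> 2 * t\<^sup>2 < M}"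
  have fin: "finite ?T"
    by (rule finite_subset[of _ "{..M}"]) (auto simp: power2_eq_square intro: order_trans[OF le_square])
  have img: "{k. 0 < k \<and> k\<^sup>2 < N \<and> even k} = (*) 2 ` ?T"
    by (auto simp: N power_mult_distrib elim!: evenE)
  have "(\<Sum>k | 0 < k \<and> k\<^sup>2 < N \<and> even k. sigma0 (N - k\<^sup>2)) = (\<Sum>t\<in>?T. sigma0 (N - (2 * t)\<^sup>2))"
    unfolding img by (subst sum.reindex) (auto simp: inj_on_def)
  also have "\<dots> = (\<Sum>t\<in>?T. 2 * sigma0 (M - 2 * t\<^sup>2))"
  proof (rule sum.cong)
    fix t assume "t \<in> ?T"
    then have "odd (M - 2 * t\<^sup>2)" using assms(1) by auto
    moreover have "N - (2 * t)\<^sup>2 = 2 * (M - 2 * t\<^sup>2)" by (simp add: N power_mult_distrib)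
    ultimately show "sigma0 (N - (2 * t)\<^sup>2) = 2 * sigma0 (M - 2 * t\<^sup>2)" by (simp add: sigma0_double)
  qed simp
  also have "\<dots> = 2 * (\<Sum>t\<in>?T. sigma0 (M - 2 * t\<^sup>2))" by (simp add: sum_distrib_left)
  finally have eq: "(\<Sum>k | 0 < k \<and> k\<^sup>2 < N \<and> even k. sigma0 (N - k\<^sup>2)) = 2 * (\<Sum>t\<in>?T. sigma0 (M - 2 * t\<^sup>2))" .
  \<comment> \<open>Only square arguments have an odd divisor count, and \<open>t\<close> determines
    the natural number \<open>s\<close>, so the odd terms count representations of
    \<open>M\<close>.\<close>
  have "{t\<in>?T. odd (sigma0 (M - 2 * t\<^sup>2))} = {t. 0 < t \<and> (\<exists>s. s\<^sup>2 + 2 * t\<^sup>2 = M)}"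
  proof (intro equalityI subsetI)
    fix t assume "t \<in> {t\<in>?T. odd (sigma0 (M - 2 * t\<^sup>2))}"
    then have t: "0 < t" "2 * t\<^sup>2 < M" "odd (sigma0 (M - 2 * t\<^sup>2))" by auto
    then obtain s where "M - 2 * t\<^sup>2 = s\<^sup>2" using even_sigma0_iff[of "M - 2 * t\<^sup>2"] by auto
    then have "s\<^sup>2 + 2 * t\<^sup>2 = M" using t by linarith
    then show "t \<in> {t. 0 < t \<and> (\<exists>s. s\<^sup>2 + 2 * t\<^sup>2 = M)}" using t by blast
  next
    fix t assume "t \<in> {t. 0 < t \<and> (\<exists>s. s\<^sup>2 + 2 * t\<^sup>2 = M)}"
    then obtain s where s: "0 < t" "s\<^sup>2 + 2 * t\<^sup>2 = M" by blast
    \<comment> \<open>With \<open>s = 0\<close> the number \<open>M = 2 * t\<^sup>2\<close> would be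
      even. Hence \<open>s > 0\<close>, which gives the strict bound in \<open>?T\<close>.\<close>
    then have "s \<noteq> 0" using assms(1) by (intro notI) auto
    then have "0 < s\<^sup>2" by simp
    then have "2 * t\<^sup>2 < M" using s(2) by linarith
    moreover have "M - 2 * t\<^sup>2 = s\<^sup>2" using s(2) by linarith
    moreover have "odd (sigma0 (s\<^sup>2))" using even_sigma0_iff[OF \<open>0 < s\<^sup>2\<close>] by blast
    ultimately show "t \<in> {t\<in>?T. odd (sigma0 (M - 2 * t\<^sup>2))}" using s(1) by simp
  qed
  then have "even (\<Sum>t\<in>?T. sigma0 (M - 2 * t\<^sup>2))"
    using assms(3) fin by (simp add: even_sum_iff)
  then show ?thesis unfolding eq by (auto elim!: evenE)
qed

section \<open>Representations by the form \<open>s\<^sup>2 + 2 t\<^sup>2\<close>\<close>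

text \<open>After normalisation, \<open>s + t sqrt(-2)\<close> is \<open>1 + sqrt(-2)\<close> times
  an element of norm \<open>u\<close> in Z[sqrt(-2)]. The pairing conjugates this cofactor, up to
  sign. At a fixed point the cofactor would be an integer or an integer multiple of
  \<open>sqrt(-2)\<close>, making \<open>u\<close> a square or twice a square.\<close>

lemma even_card_representations:
  fixes M u :: nat
  assumes M: "M = 3 * u" and "odd u" and "\<not> 3 dvd u" and nsq: "\<nexists>s. u = s\<^sup>2"
  shows "even (card {t. 0 < t \<and> (\<exists>s. s\<^sup>2 + 2 * t\<^sup>2 = M)})"
proof -
  \<comment> \<open>The sign of \<open>t\<close> is normalised by \<open>s \<equiv> t (mod 3)\<close>. Then \<open>?f\<close> multiplies \<open>s + t\<surd>-2\<close> by the norm-one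
    element \<open>(-1 + 2\<surd>-2)/3\<close>, up to conjugation and sign.\<close>
  let ?P = "{(s :: int, t :: int). 0 < s \<and> 3 dvd s - t \<and> s\<^sup>2 + 2 * t\<^sup>2 = int M}"
  let ?f = "\<lambda>(s :: int, t :: int). if s < 4 * t then ((4 * t - s) div 3, (2 * s + t) div 3)
     else ((s - 4 * t) div 3, (- 2 * s - t) div 3)"
  \<comment> \<open>As 9 does not divide \<open>M\<close>, the condition \<open>3 dvd s - t\<close>
    can hold for only one of the signs of \<open>t\<close>; this gives injectivity of
    \<open>|t|\<close> below.\<close>
  have sq_dvd: "\<not> (3 dvd s \<and> 3 dvd t)" if "s\<^sup>2 + 2 * t\<^sup>2 = int M" for s t :: int
  proof
    assume "3 dvd s \<and> 3 dvd t"
    then obtain x y where "s = 3 * x" "t = 3 * y" by (auto elim!: dvdE)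
    then have "3 * (3 * (x\<^sup>2 + 2 * y\<^sup>2)) = 3 * int u"
      using that M by (simp add: power_mult_distrib)
    then have "3 dvd int u" by presburger
    then show False using assms(3) by presburger
  qed
  have A: "\<exists>y. s = t + 3 * y" if "3 dvd s - t" for s t :: int using that by (metis add.commute diff_add_cancel dvdE)
  \<comment> \<open>Fixed points of \<open>?f\<close> would have \<open>s = t\<close> or
    \<open>s = - 2 * t\<close>; \<open>s \<noteq> 4 * t\<close> keeps the new first coordinate
    positive.\<close>
  have nz: "s \<noteq> 4 * t" "s \<noteq> t" "s \<noteq> - 2 * t" if "s\<^sup>2 + 2 * t\<^sup>2 = int M" for s t :: int
  proof -
    have "odd (s\<^sup>2 + 2 * t\<^sup>2)" unfolding that using M assms(2) by simp
    then have od: "odd s" by simp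
    show "s \<noteq> 4 * t" "s \<noteq> - 2 * t" using od by auto
    show "s \<noteq> t"
    proof
      assume "s = t"
      then have "int u = s\<^sup>2" using that M by simp
      then have "u = (nat \<bar>s\<bar>)\<^sup>2" by (metis nat_abs_mult_distrib nat_int power2_eq_square abs_power2 power2_abs nat_power_eq abs_ge_zero)
      then show False using nsq by blast
    qed
  qed
  have finP: "finite ?P"
  proof (rule finite_subset)
    show "?P \<subseteq> {- int M..int M} \<times> {- int M..int M}"
    proof
      fix z assume "z \<in> ?P"
      then obtain s t where z: "z = (s, t)" "s\<^sup>2 + 2 * t\<^sup>2 = int M" by auto
      then show "z \<in> {- int M..int M} \<times> {- int M..int M}"
        using abs_le_power2_int[of s] abs_le_power2_int[of t] zero_le_power2[of s] zero_le_power2[of t]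
        by (auto simp: abs_le_iff)
    qed
  qed simp
  have f: "?f z \<in> ?P \<and> ?f (?f z) = z \<and> ?f z \<noteq> z" if "z \<in> ?P" for z
  proof -
    obtain s t where z: "z = (s, t)" by (cases z)
    with that have st: "0 < s" "3 dvd s - t" "s\<^sup>2 + 2 * t\<^sup>2 = int M" by auto
    obtain y where y: "s = t + 3 * y" using A[OF st(2)] by blast
    have e: "(4 * t - s) div 3 = t - y" "(2 * s + t) div 3 = t + 2 * y"
      "(s - 4 * t) div 3 = y - t" "(- 2 * s - t) div 3 = - t - 2 * y" by (simp_all add: y)
    have n: "s \<noteq> 4 * t" "s \<noteq> t" "s \<noteq> - 2 * t" using nz[OF st(3)] by auto
    have q: "(t - y)\<^sup>2 + 2 * (t + 2 * y)\<^sup>2 = int M" "(y - t)\<^sup>2 + 2 * (- t - 2 * y)\<^sup>2 = int M"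
      using st(3) unfolding y by (simp_all add: power2_eq_square algebra_simps)
    show ?thesis
    proof (cases "s < 4 * t")
      case True
      have "?f z = (t - y, t + 2 * y)" using True e by (simp add: z)
      moreover have "?f (t - y, t + 2 * y) = (s, t)" using st(1) y by simp
      moreover have "3 dvd (t - y) - (t + 2 * y)" by simp
      ultimately show ?thesis using True n q y z by auto
    next
      case False
      have "?f z = (y - t, - t - 2 * y)" using False e by (simp add: z)
      moreover have "?f (y - t, - t - 2 * y) = (s, t)" using st(1) y by simp
      moreover have "3 dvd (y - t) - (- t - 2 * y)" by simp
      ultimately show ?thesis using False n q y z by auto
    qed
  qed
  have "even (card ?P)"
    by (rule even_card_fixpoint_free[OF finP f[THEN conjunct1] f[THEN conjunct2, THEN conjunct1]
          f[THEN conjunct2, THEN conjunct2]])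
  moreover have "bij_betw (\<lambda>(s, t). nat \<bar>t\<bar>) ?P {t. 0 < t \<and> (\<exists>s. s\<^sup>2 + 2 * t\<^sup>2 = M)}"
  proof (intro bij_betw_imageI inj_onI equalityI subsetI)
    fix z w assume z: "z \<in> ?P" and w: "w \<in> ?P" and eq: "(case z of (s, t) \<Rightarrow> nat \<bar>t\<bar>) = (case w of (s, t) \<Rightarrow> nat \<bar>t\<bar>)"
    obtain s t s' t' where zw: "z = (s, t)" "w = (s', t')" by (cases z, cases w)
    then have abs: "\<bar>t\<bar> = \<bar>t'\<bar>" using eq by auto
    then have "t\<^sup>2 = t'\<^sup>2" by (metis power2_abs)
    moreover have "s\<^sup>2 + 2 * t\<^sup>2 = int M" "s'\<^sup>2 + 2 * t'\<^sup>2 = int M" using z w zw by auto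
    ultimately have "s\<^sup>2 = s'\<^sup>2" by linarith
    moreover have "0 < s" "0 < s'" using z w zw by auto
    ultimately have ss: "s = s'" by (simp add: power2_eq_iff_nonneg)
    show "z = w"
    proof (rule ccontr)
      assume "z \<noteq> w"
      then have "t' = - t" using abs ss zw by auto
      then have "3 dvd s - t" "3 dvd s + t" using z w zw ss by auto
      then have "3 dvd s \<and> 3 dvd t" by presburger
      then show False using sq_dvd z zw by auto
    qed
  next
    fix t assume "t \<in> (\<lambda>(s, t). nat \<bar>t\<bar>) ` ?P"
    then obtain s t' where *: "t = nat \<bar>t'\<bar>" "s > 0" "3 dvd s - t'" "s\<^sup>2 + 2 * t'\<^sup>2 = int M" by auto
    have "t' \<noteq> 0"
    proof
      assume "t' = 0"
      then show False using * sq_dvd[of s t'] by simp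
    qed
    moreover have "(nat s)\<^sup>2 + 2 * t\<^sup>2 = M"
    proof -
      have "int ((nat s)\<^sup>2 + 2 * t\<^sup>2) = int M" using * by simp
      then show ?thesis by linarith
    qed
    ultimately show "t \<in> {t. 0 < t \<and> (\<exists>s. s\<^sup>2 + 2 * t\<^sup>2 = M)}" using *(1) by auto
  next
    fix t assume "t \<in> {t. 0 < t \<and> (\<exists>s. s\<^sup>2 + 2 * t\<^sup>2 = M)}"
    then obtain s where s: "0 < t" "s\<^sup>2 + 2 * t\<^sup>2 = M" by blast
    then have s': "(int s)\<^sup>2 + 2 * (int t)\<^sup>2 = int M" by (metis of_nat_add of_nat_mult of_nat_power of_nat_numeral)
    have "3 dvd (int s)\<^sup>2 + 2 * (int t)\<^sup>2" using s' M by simp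
    \<comment> \<open>Modulo 3 the form is \<open>s\<^sup>2 - t\<^sup>2\<close>, so one of the signs
      of \<open>t\<close> meets the normalisation.\<close>
    then have "3 dvd (int s)\<^sup>2 + 2 * (int t)\<^sup>2 - 3 * (int t)\<^sup>2" by (intro dvd_diff) auto
    then have "3 dvd (int s - int t) * (int s - (- int t))" by (simp add: power2_eq_square algebra_simps)
    then have "3 dvd int s - int t \<or> 3 dvd int s - (- int t)"
      using prime_dvd_mult_iff[of "3::int"] by simp
    moreover have "s \<noteq> 0" using s assms(2) M by (metis even_mult_iff even_add odd_numeral zero_power2 add_0 dvd_triv_left)
    ultimately have "(int s, int t) \<in> ?P \<or> (int s, - int t) \<in> ?P" using s' by auto
    moreover have "t = (\<lambda>(s, t). nat \<bar>t\<bar>) (int s, int t)" "t = (\<lambda>(s, t). nat \<bar>t\<bar>) (int s, - int t)" by simp_all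
    ultimately show "t \<in> (\<lambda>(s, t). nat \<bar>t\<bar>) ` ?P" by (elim disjE) (rule image_eqI, assumption+)+
  qed
  ultimately show ?thesis by (simp add: bij_betw_same_card)
qed

subsection \<open>Odd \<open>k\<close>\<close>

text \<open>A pair \<open>(e, r)\<close> stands for the form \<open>e x\<^sup>2 + 2 r x y - ((N - r\<^sup>2) / e) y\<^sup>2\<close> of discriminant \<open>4 N\<close>,
  where \<open>r\<close> is the least representative of its class modulo \<open>e\<close> in the interval \<open>(-\<surd>N, \<surd>N)\<close>.\<close>

definition reduced :: "int \<Rightarrow> (int \<times> int) set" where
  "reduced N = {(e, r). 0 < e \<and> even e \<and> e dvd N - r\<^sup>2 \<and> r\<^sup>2 < N \<and> N < (r - e)\<^sup>2}"

lemma finite_reduced: "finite (reduced N)"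
proof (rule finite_subset)
  show "reduced N \<subseteq> {0..N} \<times> {-N..N}"
  proof (clarsimp simp: reduced_def)
    fix e r :: int assume *: "0 < e" "e dvd N - r\<^sup>2" "r\<^sup>2 < N"
    then have "e \<le> N - r\<^sup>2" by (intro zdvd_imp_le) auto
    then show "e \<le> N \<and> - N \<le> r \<and> r \<le> N"
      using * abs_le_power2_int[of r] by (smt (verit) zero_le_power2)
  qed
qed simp

lemma int_sqrt_exists:
  fixes N :: int
  assumes "0 < N"
  obtains s where "0 \<le> s" "s\<^sup>2 \<le> N" "N < (s + 1)\<^sup>2"
proof -
  have N: "0 \<le> real_of_int N" using assms by simp
  let ?s = "\<lfloor>sqrt (real_of_int N)\<rfloor>"
  have 0: "0 \<le> ?s" using N by simp
  have "real_of_int (?s\<^sup>2) = (real_of_int ?s)\<^sup>2" by simp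
  also have "\<dots> \<le> (sqrt (real_of_int N))\<^sup>2" using 0 by (intro power_mono) auto
  finally have 1: "?s\<^sup>2 \<le> N" using N by simp
  have "(sqrt (real_of_int N))\<^sup>2 < (real_of_int ?s + 1)\<^sup>2" using N by (intro power_strict_mono) auto
  then have "real_of_int N < real_of_int ((?s + 1)\<^sup>2)" using N by simp
  then have 2: "N < (?s + 1)\<^sup>2" by linarith
  show ?thesis using that 0 1 2 by blast
qed

lemma not_square_mod_4:
  fixes x :: int
  assumes "N mod 4 = 2"
  shows "x\<^sup>2 \<noteq> N"
proof (cases "even x")
  case True
  then obtain y where "x = 2 * y" by (elim evenE)
  then have "x\<^sup>2 = 4 * y\<^sup>2" by simp
  then show ?thesis using assms by (metis mod_mult_self1_is_0 zero_neq_numeral)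
next
  case False
  then have "odd (x\<^sup>2)" by simp
  moreover have "even N" using assms by presburger
  ultimately show ?thesis by auto
qed

text \<open>Since \<open>r\<close> is even, \<open>N - r\<^sup>2\<close> is 2 modulo 4. Its single
  factor 2 lies in \<open>e\<close>, leaving the cofactor odd.\<close>

lemma reduced_parity:
  fixes N e r :: int
  assumes "N mod 4 = 2" and "even e" and "e dvd N - r\<^sup>2"
  shows "even r" "e mod 4 = 2" "odd ((N - r\<^sup>2) div e)"
proof -
  have "2 dvd N - r\<^sup>2" using assms(2,3) by (rule dvd_trans)
  moreover have "even N" using assms(1) by presburger
  ultimately show r: "even r" by simp
  then obtain y where "r = 2 * y" by (elim evenE)
  then have "(N - r\<^sup>2) mod 4 = 2" using assms(1) 
    by (simp add: power_mult_distrib mod_diff_eq[symmetric])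
  moreover obtain b where b: "N - r\<^sup>2 = e * b" using assms(3) by (elim dvdE)
  moreover obtain c where c: "e = 2 * c" using assms(2) by (elim evenE)
  ultimately have "(2 * (c * b)) mod 4 = 2" by (simp add: mult.assoc)
  moreover have "(2 * x) mod 4 = 2 \<Longrightarrow> odd x" for x :: int by presburger
  ultimately have "odd (c * b)" by blast
  then have cb: "odd c" "odd b" by auto
  then show "e mod 4 = 2" using c by presburger
  then have "e \<noteq> 0" by auto
  then show "odd ((N - r\<^sup>2) div e)" using b cb by simp
qed

section \<open>The parity of the number of reduced forms\<close>

text \<open>The interval \<open>(-\<surd>N, \<surd>N)\<close> is symmetric, so negating residue
  classes permutes the classes that meet it. A class equal to its negative is the zero class, and
  zero is a square root of \<open>N\<close> modulo \<open>e\<close> exactly when \<open>e\<close>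
  divides \<open>N\<close>.\<close>

lemma even_card_reduced_iff:
  fixes N :: int
  assumes N: "0 < N" "N mod 4 = 2"
  shows "even (card {(e, r) \<in> reduced N. Q (e div 2)}) \<longleftrightarrow> even (card {d. 0 < d \<and> 2 * d dvd N \<and> Q d})"
proof -
  obtain s where s: "0 \<le> s" "s\<^sup>2 \<le> N" "N < (s + 1)\<^sup>2" by (rule int_sqrt_exists[OF N(1)])
  have lt_iff: "x\<^sup>2 < N \<longleftrightarrow> \<bar>x\<bar> \<le> s" for x
  proof
    assume "x\<^sup>2 < N"
    then have "\<bar>x\<bar>\<^sup>2 < (s + 1)\<^sup>2" unfolding power2_abs using s by linarith
    then have "\<bar>x\<bar> < s + 1" by (rule power_less_imp_less_base) (use s in simp)
    then show "\<bar>x\<bar> \<le> s" by simp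
  next
    assume "\<bar>x\<bar> \<le> s"
    then have "\<bar>x\<bar>\<^sup>2 \<le> s\<^sup>2" by (intro power_mono) auto
    then show "x\<^sup>2 < N" unfolding power2_abs using s(2) not_square_mod_4[OF N(2), of x] by linarith
  qed
  have gt_iff: "N < x\<^sup>2 \<longleftrightarrow> s < \<bar>x\<bar>" for x
    using lt_iff[of x] not_square_mod_4[OF N(2), of x] by linarith
  let ?R = "{(e, r) \<in> reduced N. Q (e div 2)}"
  \<comment> \<open>This is \<open>r \<mapsto> - r\<close> on residue classes modulo \<open>e\<close>.\<close>
  let ?f = "\<lambda>(e, r). (e, (s - r) mod e - s)"
  \<comment> \<open>Given \<open>r \<le> s\<close> and \<open>0 < e\<close>, the condition
    \<open>N < (r - e)\<^sup>2\<close> can only mean \<open>r - e < - s\<close>: the previous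
    representative lies below the interval.\<close>
  have R_iff: "(e, r) \<in> ?R \<longleftrightarrow> 0 < e \<and> even e \<and> Q (e div 2) \<and> e dvd N - r\<^sup>2 \<and> - s \<le> r \<and> r \<le> s \<and> r < e - s" for e r
    unfolding reduced_def using lt_iff gt_iff by auto
  have f: "?f z \<in> ?R" "?f (?f z) = z" if "z \<in> ?R" for z
  proof -
    obtain e r where z: "z = (e, r)" by (cases z)
    have er: "0 < e" "even e" "Q (e div 2)" "e dvd N - r\<^sup>2" "- s \<le> r" "r \<le> s" "r < e - s"
      using that R_iff z by auto
    define r' where "r' = (s - r) mod e - s"
    \<comment> \<open>Reduction of the nonnegative \<open>s - r\<close> can only lower it, so
      \<open>r' \<le> - r \<le> s\<close>: the new representative stays in the interval.\<close>
    have "(s - r) mod e \<le> s - r" using er by (intro zmod_le_nonneg_dividend) auto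
    then have b: "- s \<le> r'" "r' \<le> s" "r' < e - s" using er by (auto simp: r'_def)
    have "[r' = - r] (mod e)" by (simp add: r'_def cong_def mod_simps)
    then have "[N - r'\<^sup>2 = N - (- r)\<^sup>2] (mod e)" by (intro cong_diff cong_pow cong_refl)
    then have "e dvd N - r'\<^sup>2" using er(4) cong_dvd_iff by force
    then show "?f z \<in> ?R" using R_iff er b by (simp add: z r'_def)
    have "(s - r') mod e = (s + r) mod e" by (simp add: r'_def mod_simps)
    also have "\<dots> = s + r" using er by simp
    finally show "?f (?f z) = z" by (simp add: z r'_def)
  qed
  have "even (card ?R) \<longleftrightarrow> even (card {z \<in> ?R. ?f z = z})"
    using f finite_subset[OF _ finite_reduced, of ?R N]
    by (intro even_card_involution) auto
  \<comment> \<open>The zero class always meets the interval; \<open>s mod (2 * d) - s\<close> is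
    the least multiple of \<open>2 * d\<close> that is at least \<open>- s\<close>.\<close>
  also have "bij_betw (\<lambda>d. (2 * d, s mod (2 * d) - s)) {d. 0 < d \<and> 2 * d dvd N \<and> Q d} {z \<in> ?R. ?f z = z}"
  proof (intro bij_betw_imageI inj_onI equalityI subsetI)
    fix z assume "z \<in> (\<lambda>d. (2 * d, s mod (2 * d) - s)) ` {d. 0 < d \<and> 2 * d dvd N \<and> Q d}"
    then obtain d where d: "z = (2 * d, s mod (2 * d) - s)" "0 < d" "2 * d dvd N" "Q d" by auto
    define r where "r = s mod (2 * d) - s"
    have dr: "2 * d dvd r" unfolding r_def by (metis dvd_minus_mod dvd_minus_iff minus_diff_eq)
    then have "2 * d dvd N - r\<^sup>2" using d(3) by (simp add: power2_eq_square)
    moreover have "s mod (2 * d) \<le> s" using s d by (intro zmod_le_nonneg_dividend) auto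
    moreover have "s mod (2 * d) < 2 * d" "0 \<le> s mod (2 * d)" using d by auto
    ultimately have "(2 * d, r) \<in> ?R" unfolding R_iff using d s by (auto simp: r_def)
    moreover have "(s - r) mod (2 * d) = s mod (2 * d)" using dr by (simp add: mod_eq_dvd_iff)
    ultimately show "z \<in> {z \<in> ?R. ?f z = z}" using d(1) by (simp add: r_def)
  next
    fix z assume z: "z \<in> {z \<in> ?R. ?f z = z}"
    obtain e r where er: "z = (e, r)" by (cases z)
    have r: "(e, r) \<in> ?R" "(s - r) mod e = r + s" using z er by auto
    then have *: "0 < e" "even e" "Q (e div 2)" "e dvd N - r\<^sup>2" "- s \<le> r" "r < e - s" using R_iff by auto
    obtain c where c: "e = 2 * c" using *(2) by (elim evenE)
    have par: "even r" "e mod 4 = 2" using reduced_parity[OF N(2) *(2,4)] by auto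
    \<comment> \<open>At a fixed point \<open>e\<close> divides \<open>2 * r\<close>, so
      \<open>c\<close> divides \<open>r\<close>. As \<open>c\<close> is odd and \<open>r\<close>
      even, \<open>e = 2 * c\<close> divides \<open>r\<close>.\<close>
    have "(s - r) mod e = (s + r) mod e" using r(2) * by (simp add: add.commute)
    then have "e dvd (s - r) - (s + r)" by (simp add: mod_eq_dvd_iff)
    then obtain m where "(s - r) - (s + r) = e * m" by (elim dvdE)
    then have "r = c * (- m)" using c by simp
    then have "c dvd r" by (rule dvdI)
    moreover have "odd c" using par(2) c by presburger
    ultimately have "c * 2 dvd r" using par(1) by (intro divides_mult) auto
    then have er': "e dvd r" using c by (simp add: mult.commute)
    then have "e dvd r\<^sup>2" by (simp add: power2_eq_square)
    then have "e dvd N" using *(4) dvd_add[of e "N - r\<^sup>2" "r\<^sup>2"] by simp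
    moreover have "s mod e = (s - r) mod e" using er' by (simp add: mod_eq_dvd_iff)
    ultimately show "z \<in> (\<lambda>d. (2 * d, s mod (2 * d) - s)) ` {d. 0 < d \<and> 2 * d dvd N \<and> Q d}"
      using * c er r(2) by (intro image_eqI[of _ _ c]) auto
  qed auto
  then have "card {z \<in> ?R. ?f z = z} = card {d. 0 < d \<and> 2 * d dvd N \<and> Q d}"
    by (simp add: bij_betw_same_card)
  finally show ?thesis .
qed

section \<open>From triples with odd \<open>k\<close> to reduced forms\<close>

text \<open>Swapping \<open>a\<close> and \<open>b\<close> sends the end values
  \<open>v = a + 2 * k - b\<close> and \<open>w = a - 2 * k - b\<close> to \<open>- w\<close> and
  \<open>- v\<close>. Exactly one end satisfies \<open>Q\<close> (on the halved absolute value), so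
  of a triple and its swap exactly one has this selected value positive; hence the factor 2. The
  remaining triples match the reduced forms by a change of basis.\<close>

lemma card_odd_triples:
  fixes N :: int
  assumes N: "N mod 4 = 2"
    and Q: "\<And>x y h. 0 < x \<Longrightarrow> 0 < y \<Longrightarrow> odd h \<Longrightarrow> x * y = \<bar>h\<^sup>2 - N\<bar> \<Longrightarrow> Q x \<noteq> Q y"
  shows "card {(a, k, b). 0 < a \<and> 0 < k \<and> 0 < b \<and> odd k \<and> k\<^sup>2 + a * b = N}
    = 2 * card {(e, r) \<in> reduced N. Q (e div 2)}"
proof -
  let ?C = "{(a, k, b). 0 < a \<and> 0 < k \<and> 0 < b \<and> odd k \<and> k\<^sup>2 + a * b = N}"
  \<comment> \<open>\<open>D\<close> keeps the triples whose selected end value is positive.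
    \<open>W\<close> lets \<open>k\<close> have either sign and demands that the selected end be
    \<open>a + 2 * k - b\<close>.\<close>
  define D where "D = {(a, k, b). (a, k, b) \<in> ?C \<and>
    (0 < a + 2 * k - b \<and> Q ((a + 2 * k - b) div 2) \<or> 0 < a - 2 * k - b \<and> Q ((a - 2 * k - b) div 2))}"
  define W where "W = {(a, k, b). 0 < a \<and> 0 < b \<and> odd k \<and> k\<^sup>2 + a * b = N \<and>
    0 < a + 2 * k - b \<and> Q ((a + 2 * k - b) div 2)}"
  \<comment> \<open>\<open>(a + 2k - b)(a - 2k - b) = (a + b)\<^sup>2 - 4 N\<close>\<close>
  have alt: "Q (\<bar>a + 2 * k - b\<bar> div 2) \<noteq> Q (\<bar>a - 2 * k - b\<bar> div 2)"
    "a + 2 * k - b \<noteq> 0" "a - 2 * k - b \<noteq> 0"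
    if *: "odd k" "k\<^sup>2 + a * b = N" for a k b
  proof -
    obtain j where j: "k = 2 * j + 1" using *(1) by (elim oddE)
    have k2: "k\<^sup>2 = 4 * (j\<^sup>2 + j) + 1" by (simp add: j power2_eq_square algebra_simps)
    have "a * b = N - 4 * (j\<^sup>2 + j) - 1" using *(2) k2 by simp
    moreover have "(N - 4 * x - 1) mod 4 = 1" for x using N by presburger
    ultimately have ab: "(a * b) mod 4 = 1" by (simp only:)
    moreover have "x mod 4 = 1 \<Longrightarrow> odd x" for x :: int by presburger
    ultimately have "odd (a * b)" by blast
    then have "odd a" "odd b" by auto
    then obtain p q where pq: "a = 2 * p + 1" "b = 2 * q + 1" by (elim oddE)
    have "a * b = 4 * (p * q) + 2 * (p + q) + 1" by (simp add: pq algebra_simps)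
    moreover have "(4 * x + 2 * y + 1) mod 4 = 1 \<Longrightarrow> even y" for x y :: int by presburger
    ultimately have "even (p + q)" using ab by metis
    \<comment> \<open>Since \<open>a * b\<close> is 1 modulo 4, \<open>a\<close> and
      \<open>b\<close> agree modulo 4. So \<open>(a + b) / 2 = p + q + 1 = 2 * h + 1\<close> is odd,
      as the hypothesis on \<open>Q\<close> requires.\<close>
    then obtain h where h: "p + q = 2 * h" by (elim evenE)
    have q': "q = 2 * h - p" using h by simp
    have xy: "a + 2 * k - b = 2 * (p - q + k)" "a - 2 * k - b = 2 * (p - q - k)" by (simp_all add: pq)
    have "odd (p - q + k)" "odd (p - q - k)" using h *(1) by presburger+
    then have nz: "p - q + k \<noteq> 0" "p - q - k \<noteq> 0" by presburger+
    have pr: "(p - q + k) * (p - q - k) = (2 * h + 1)\<^sup>2 - N"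
      using *(2) by (simp add: pq q' power2_eq_square algebra_simps)
    have "Q \<bar>p - q + k\<bar> \<noteq> Q \<bar>p - q - k\<bar>"
      using nz pr by (intro Q[where h = "2 * h + 1"]) (auto simp flip: abs_mult)
    moreover have "\<bar>a + 2 * k - b\<bar> div 2 = \<bar>p - q + k\<bar>" "\<bar>a - 2 * k - b\<bar> div 2 = \<bar>p - q - k\<bar>"
      unfolding xy by (simp_all add: abs_mult)
    ultimately show "Q (\<bar>a + 2 * k - b\<bar> div 2) \<noteq> Q (\<bar>a - 2 * k - b\<bar> div 2)" by simp
    show "a + 2 * k - b \<noteq> 0" "a - 2 * k - b \<noteq> 0" unfolding xy using nz by auto
  qed
  have finC: "finite ?C"
  proof (rule finite_subset)
    show "?C \<subseteq> {0..N} \<times> {0..N} \<times> {0..N}"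
    proof
      fix z assume "z \<in> ?C"
      then obtain a k b where z: "z = (a, k, b)" "0 < a" "0 < k" "0 < b" "k\<^sup>2 + a * b = N" by auto
      have "a * 1 \<le> a * b" "1 * b \<le> a * b"
        using z by (auto intro!: mult_left_mono mult_right_mono)
      then have "a \<le> N" "b \<le> N" "k \<le> N"
        using z abs_le_power2_int[of k] zero_le_power2[of k] by linarith+
      then show "z \<in> {0..N} \<times> {0..N} \<times> {0..N}" using z by simp
    qed
  qed simp
  let ?sw = "\<lambda>(a, k, b). (b, k, a) :: int \<times> int \<times> int"
  have split: "?C = D \<union> ?sw ` D" "D \<inter> ?sw ` D = {}"
  proof -
    have D_iff: "(a, k, b) \<in> D \<longleftrightarrow>
         (0 < a + 2 * k - b \<and> Q (\<bar>a + 2 * k - b\<bar> div 2) \<or> 0 < a - 2 * k - b \<and> Q (\<bar>a - 2 * k - b\<bar> div 2))"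
      if "(a, k, b) \<in> ?C" for a k b
      using that unfolding D_def by auto
    have mem: "(b, k, a) \<in> D \<longleftrightarrow> (a, k, b) \<notin> D" if C: "(a, k, b) \<in> ?C" for a k b
    proof -
      have *: "odd k" "k\<^sup>2 + a * b = N" using C by auto
      have C': "(b, k, a) \<in> ?C" using C by (auto simp: mult.commute)
      have neg: "b + 2 * k - a = - (a - 2 * k - b)" "b - 2 * k - a = - (a + 2 * k - b)" by simp_all
      have "0 < x \<or> x < 0" "\<not> (0 < x \<and> x < 0)" if "x \<noteq> 0" for x :: int using that by auto
      then show ?thesis
        unfolding D_iff[OF C] D_iff[OF C'] neg abs_minus neg_0_less_iff_less using alt[OF *] by blast
    qed
    have sub: "D \<subseteq> ?C" by (auto simp: D_def)
    have swC: "(b, k, a) \<in> ?C" if "(a, k, b) \<in> ?C" for a k b using that by (auto simp: mult.commute)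
    show "?C = D \<union> ?sw ` D"
    proof (intro equalityI subsetI)
      fix z assume z: "z \<in> ?C"
      obtain a k b where abk: "z = (a, k, b)" by (cases z)
      show "z \<in> D \<union> ?sw ` D"
      proof (cases "z \<in> D")
        case False
        then have "(b, k, a) \<in> D" using mem z abk by auto
        then show ?thesis using abk by force
      qed simp
    next
      fix z assume "z \<in> D \<union> ?sw ` D"
      then show "z \<in> ?C"
      proof
        assume "z \<in> ?sw ` D"
        then obtain a k b where "z = (b, k, a)" "(a, k, b) \<in> D" by auto
        then show ?thesis using sub swC[of a k b] by auto
      qed (use sub in auto)
    qed
    have False if "z \<in> D" "z \<in> ?sw ` D" for z
    proof -
      obtain a k b where "z = (b, k, a)" "(a, k, b) \<in> D" using \<open>z \<in> ?sw ` D\<close> by auto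
      moreover from this have "(a, k, b) \<in> ?C" using sub by auto
      ultimately show False using mem[of a k b] \<open>z \<in> D\<close> by simp
    qed
    then show "D \<inter> ?sw ` D = {}" by (intro equals0I) (elim IntE)
  qed
  have finD: "finite D" by (rule finite_subset[OF _ finC]) (auto simp: D_def)
  have "card ?C = card (D \<union> ?sw ` D)" by (rule arg_cong[OF split(1)])
  also have "\<dots> = card D + card (?sw ` D)"
    by (rule card_Un_disjoint[OF finD finite_imageI[OF finD] split(2)])
  also have "card (?sw ` D) = card D" by (intro card_image inj_onI) auto
  also have "card D = card W"
  proof -
    \<comment> \<open>Changing the sign of \<open>k\<close> exchanges the two end values, and
      \<open>alt\<close> lets only one of them be selected, so the sign is determined.\<close>
    have "bij_betw (\<lambda>(a, k, b). (a, \<bar>k\<bar>, b)) W D"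
    proof (intro bij_betw_imageI inj_onI equalityI subsetI)
      fix z w assume z: "z \<in> W" and w: "w \<in> W"
        and eq: "(case z of (a, k, b) \<Rightarrow> (a, \<bar>k\<bar>, b)) = (case w of (a, k, b) \<Rightarrow> (a, \<bar>k\<bar>, b))"
      obtain a k b a' k' b' where zw: "z = (a, k, b)" "w = (a', k', b')" by (cases z, cases w)
      then have eqs: "a' = a" "b' = b" "k' = k \<or> k' = - k" using eq by auto
      have "k' \<noteq> - k"
      proof
        assume "k' = - k"
        then have "0 < a + 2 * k - b" "Q ((a + 2 * k - b) div 2)" "0 < a - 2 * k - b" "Q ((a - 2 * k - b) div 2)"
          "odd k" "k\<^sup>2 + a * b = N"
          using z w zw eqs by (simp_all add: W_def)
        then show False using alt(1)[of k a b] by simp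
      qed
      then show "z = w" using eqs zw by simp
    next
      fix z assume "z \<in> (\<lambda>(a, k, b). (a, \<bar>k\<bar>, b)) ` W"
      then obtain a k b where *: "(a, k, b) \<in> W" "z = (a, \<bar>k\<bar>, b)" by auto
      then have "k \<noteq> 0" by (auto simp: W_def)
      then show "z \<in> D" using * by (cases "0 < k") (auto simp: W_def D_def)
    next
      fix z assume z: "z \<in> D"
      obtain a k b where abk: "z = (a, k, b)" by (cases z)
      have k: "0 < k" using z abk by (auto simp: D_def)
      have "(a, k, b) \<in> W \<or> (a, - k, b) \<in> W" using z abk by (auto simp: W_def D_def)
      then show "z \<in> (\<lambda>(a, k, b). (a, \<bar>k\<bar>, b)) ` W" using k abk by force
    qed
    then show ?thesis by (simp add: bij_betw_same_card)
  qed
  also have "card W = card {(e, r) \<in> reduced N. Q (e div 2)}"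
  proof -
    let ?R = "{(e, r) \<in> reduced N. Q (e div 2)}"
    \<comment> \<open>In the basis \<open>(1, 1), (0, 1)\<close> the form
      \<open>a x\<^sup>2 + 2 k x y - b y\<^sup>2\<close> becomes
      \<open>e x\<^sup>2 + 2 (k - b) x y - b y\<^sup>2\<close> with
      \<open>e = a + 2 k - b\<close>.\<close>
    let ?g = "\<lambda>(a, k, b). (a + 2 * k - b, k - b) :: int \<times> int"
    let ?h = "\<lambda>(e, r). let b = (N - r\<^sup>2) div e in (e - 2 * r - b, r + b, b)"
    have g: "?g z \<in> ?R \<and> ?h (?g z) = z" if "z \<in> W" for z
    proof -
      obtain a k b where z: "z = (a, k, b)" by (cases z)
      have *: "0 < a" "0 < b" "odd k" "k\<^sup>2 + a * b = N" "0 < a + 2 * k - b" "Q ((a + 2 * k - b) div 2)"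
        using that z by (auto simp: W_def)
      \<comment> \<open>For \<open>r = k - b\<close> and positive \<open>e\<close>, these identities
        translate \<open>0 < b\<close> into \<open>r\<^sup>2 < N\<close> and \<open>0 < a\<close>
        into \<open>N < (r - e)\<^sup>2\<close>.\<close>
      have 1: "N - (k - b)\<^sup>2 = (a + 2 * k - b) * b"
        using *(4) by (simp add: power2_eq_square algebra_simps)
      have 2: "((k - b) - (a + 2 * k - b))\<^sup>2 - N = (a + 2 * k - b) * a"
        using *(4) by (simp add: power2_eq_square algebra_simps)
      have "odd (k\<^sup>2)" using *(3) by simp
      moreover have "even N" using N by presburger
      ultimately have "odd (a * b)" using *(4) by (metis even_add)
      then have "even (a + 2 * k - b)" by auto
      moreover have "0 < (a + 2 * k - b) * b" "0 < (a + 2 * k - b) * a" using * by simp_all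
      moreover from this have "(k - b)\<^sup>2 < N" "N < ((k - b) - (a + 2 * k - b))\<^sup>2" using 1 2 by linarith+
      moreover have "a + 2 * k - b dvd N - (k - b)\<^sup>2" unfolding 1 by simp
      ultimately have "?g z \<in> ?R" using *(5,6) by (simp add: z reduced_def)
      moreover have "(N - (k - b)\<^sup>2) div (a + 2 * k - b) = b" unfolding 1 using *(5) by simp
      ultimately show ?thesis by (simp add: z Let_def)
    qed
    have h: "?h z \<in> W \<and> ?g (?h z) = z" if "z \<in> ?R" for z
    proof -
      obtain e r where z: "z = (e, r)" by (cases z)
      have *: "0 < e" "even e" "e dvd N - r\<^sup>2" "r\<^sup>2 < N" "N < (r - e)\<^sup>2" "Q (e div 2)"
        using that z by (auto simp: reduced_def)
      define b where "b = (N - r\<^sup>2) div e"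
      have b: "N - r\<^sup>2 = e * b" using *(3) by (simp add: b_def)
      have par: "even r" "odd b" using reduced_parity[OF N *(2,3)] by (auto simp: b_def)
      have "0 < e * b" using * b by simp
      then have b0: "0 < b" using *(1) by (simp add: zero_less_mult_iff)
      have "e * (e - 2 * r - b) = (r - e)\<^sup>2 - N" using b by (simp add: power2_eq_square algebra_simps)
      then have "0 < e * (e - 2 * r - b)" using * by simp
      then have a0: "0 < e - 2 * r - b" using *(1) by (simp add: zero_less_mult_iff)
      have eq: "(r + b)\<^sup>2 + (e - 2 * r - b) * b = N" using b by (simp add: power2_eq_square algebra_simps)
      have "?h z = (e - 2 * r - b, r + b, b)" by (simp add: z b_def Let_def)
      moreover have "e - 2 * r - b + 2 * (r + b) - b = e" by simp
      ultimately show ?thesis using a0 b0 eq par * by (auto simp: W_def z)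
    qed
    have "bij_betw ?g W ?R"
    proof (rule bij_betw_byWitness[where f' = ?h])
      show "\<forall>z\<in>W. ?h (?g z) = z" by (intro ballI g[THEN conjunct2])
      show "\<forall>z\<in>?R. ?g (?h z) = z" by (intro ballI h[THEN conjunct2])
      show "?g ` W \<subseteq> ?R" by (intro image_subsetI g[THEN conjunct1])
      show "?h ` ?R \<subseteq> W" by (intro image_subsetI h[THEN conjunct1])
    qed
    then show ?thesis by (simp add: bij_betw_same_card)
  qed
  finally show ?thesis by simp
qed

text \<open>A divisor of \<open>N - k\<^sup>2\<close> is the first factor of a unique factorisation
  \<open>a * b\<close>. Integers are used because the changes of variables on triples involve
  signs.\<close>

lemma sum_sigma0_odd_eq_card:
  fixes N :: nat
  shows "(\<Sum>k | 0 < k \<and> k\<^sup>2 < N \<and> odd k. sigma0 (N - k\<^sup>2))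
    = card {(a :: int, k :: int, b :: int). 0 < a \<and> 0 < k \<and> 0 < b \<and> odd k \<and> k\<^sup>2 + a * b = int N}"
proof -
  let ?K = "{k. 0 < k \<and> k\<^sup>2 < N \<and> odd k}"
  let ?S = "SIGMA k:?K. {d. d dvd N - k\<^sup>2}"
  let ?C = "{(a :: int, k :: int, b :: int). 0 < a \<and> 0 < k \<and> 0 < b \<and> odd k \<and> k\<^sup>2 + a * b = int N}"
  have finK: "finite ?K"
    by (rule finite_subset[of _ "{..N}"]) (auto simp: power2_eq_square intro: order_trans[OF le_square])
  have "(\<Sum>k\<in>?K. sigma0 (N - k\<^sup>2)) = card ?S"
    unfolding sigma0_def using finK by (intro card_SigmaI[symmetric]) auto
  also have "bij_betw (\<lambda>(k, d). (int d, int k, int ((N - k\<^sup>2) div d))) ?S ?C"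
  proof (rule bij_betw_byWitness[where f' = "\<lambda>(a, k, b). (nat k, nat a)"])
    show "(\<lambda>(k, d). (int d, int k, int ((N - k\<^sup>2) div d))) ` ?S \<subseteq> ?C"
    proof
      fix z assume "z \<in> (\<lambda>(k, d). (int d, int k, int ((N - k\<^sup>2) div d))) ` ?S"
      then obtain k d where z: "z = (int d, int k, int ((N - k\<^sup>2) div d))"
        and *: "0 < k" "k\<^sup>2 < N" "odd k" "d dvd N - k\<^sup>2" by auto
      from *(4) obtain b where b: "N - k\<^sup>2 = d * b" by (elim dvdE)
      then have "0 < d * b" using * by linarith
      then have db: "0 < d" "0 < b" by auto
      have "k\<^sup>2 + d * b = N" using b * by linarith
      then have "(int k)\<^sup>2 + int d * int b = int N" by (metis of_nat_add of_nat_mult of_nat_power)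
      then show "z \<in> ?C" using * db b by (simp add: z)
    qed
    have nat_eq: "(nat k)\<^sup>2 + nat a * nat b = N" "N - (nat k)\<^sup>2 = nat a * nat b"
      if "0 < a" "0 < k" "0 < b" "k\<^sup>2 + a * b = int N" for a k b
    proof -
      have "int ((nat k)\<^sup>2 + nat a * nat b) = int N" using that by simp
      then show "(nat k)\<^sup>2 + nat a * nat b = N" by linarith
      then show "N - (nat k)\<^sup>2 = nat a * nat b" by linarith
    qed
    show "(\<lambda>(a, k, b). (nat k, nat a)) ` ?C \<subseteq> ?S"
    proof
      fix z assume "z \<in> (\<lambda>(a, k, b). (nat k, nat a)) ` ?C"
      then obtain a k b where z: "z = (nat k, nat a)" and *: "0 < a" "0 < k" "0 < b" "odd k" "k\<^sup>2 + a * b = int N" by auto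
      have "0 < nat a * nat b" using * by simp
      then have "(nat k)\<^sup>2 < N" using nat_eq(1)[OF *(1-3,5)] by linarith
      then show "z \<in> ?S" using * nat_eq(2)[OF *(1-3,5)] by (simp add: z even_nat_iff)
    qed
    show "\<forall>z\<in>?C. (\<lambda>(k, d). (int d, int k, int ((N - k\<^sup>2) div d))) ((\<lambda>(a, k, b). (nat k, nat a)) z) = z"
    proof
      fix z assume "z \<in> ?C"
      then obtain a k b where z: "z = (a, k, b)" and *: "0 < a" "0 < k" "0 < b" "k\<^sup>2 + a * b = int N" by auto
      have "(N - (nat k)\<^sup>2) div nat a = nat b" using nat_eq(2)[OF *] * by simp
      then show "(\<lambda>(k, d). (int d, int k, int ((N - k\<^sup>2) div d))) ((\<lambda>(a, k, b). (nat k, nat a)) z) = z"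
        using * by (simp add: z)
    qed
  qed auto
  then have "card ?S = card ?C" by (rule bij_betw_same_card)
  finally show ?thesis .
qed

subsection \<open>Characters and divisors\<close>

text \<open>Each progression then has to supply only a predicate \<open>Q\<close> and two parities:
  \<open>divs\<close> for the self-paired classes from odd \<open>k\<close>, and \<open>reps\<close>
  for even \<open>k\<close>.\<close>

lemma sum_sigma0_cong_0_mod_4:
  fixes M N :: nat and Q :: "int \<Rightarrow> bool"
  assumes M: "odd M" and N: "N = 2 * M"
    and Q: "\<And>x y h. 0 < x \<Longrightarrow> 0 < y \<Longrightarrow> odd h \<Longrightarrow> x * y = \<bar>h\<^sup>2 - int N\<bar> \<Longrightarrow> Q x \<noteq> Q y"
    and divs: "even (card {d. 0 < d \<and> d dvd int M \<and> Q d})"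
    and reps: "even (card {t. 0 < t \<and> (\<exists>s. s\<^sup>2 + 2 * t\<^sup>2 = M)})"
  shows "[(\<Sum>k | 1 \<le> k \<and> real k < sqrt (real N). sigma0 (N - k\<^sup>2)) = 0] (mod 4)"
proof -
  have N4: "int N mod 4 = 2" "0 < int N" using M N by presburger+
  have "even (card {(e, r) \<in> reduced (int N). Q (e div 2)})"
    unfolding even_card_reduced_iff[OF N4(2,1)] using divs by (simp add: N)
  moreover have "(\<Sum>k | 0 < k \<and> k\<^sup>2 < N \<and> odd k. sigma0 (N - k\<^sup>2)) =
      2 * card {(e, r) \<in> reduced (int N). Q (e div 2)}"
    using sum_sigma0_odd_eq_card card_odd_triples[of "int N" Q, OF N4(1) Q] by (rule trans)
  ultimately have odd_part: "4 dvd (\<Sum>k | 0 < k \<and> k\<^sup>2 < N \<and> odd k. sigma0 (N - k\<^sup>2))"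
    using mult_dvd_mono[OF dvd_refl[of 2]] by force
  have eq: "{k. 1 \<le> k \<and> real k < sqrt (real N)} =
    {k. 0 < k \<and> k\<^sup>2 < N \<and> even k} \<union> {k. 0 < k \<and> k\<^sup>2 < N \<and> odd k}"
  proof -
    have "real k < sqrt (real N) \<longleftrightarrow> k\<^sup>2 < N" for k
    proof -
      have "real k < sqrt (real N) \<longleftrightarrow> sqrt ((real k)\<^sup>2) < sqrt (real N)" by simp
      also have "\<dots> \<longleftrightarrow> real (k\<^sup>2) < real N" by (simp only: real_sqrt_less_iff of_nat_power)
      finally show ?thesis by (simp only: of_nat_less_iff)
    qed
    then show ?thesis by auto
  qed
  have fin: "finite {k. 0 < k \<and> k\<^sup>2 < N \<and> A k}" for A
    by (rule finite_subset[of _ "{..N}"]) (auto simp: power2_eq_square intro: order_trans[OF le_square])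
  have "4 dvd (\<Sum>k | 1 \<le> k \<and> real k < sqrt (real N). sigma0 (N - k\<^sup>2))"
    unfolding eq using four_dvd_sum_sigma0_even[OF M N reps] odd_part
    by (subst sum.union_disjoint[OF fin fin]) auto
  then show ?thesis by (simp add: cong_0_iff)
qed

lemma finite_positive_divisors: "0 < m \<Longrightarrow> finite {d. 0 < d \<and> d dvd m \<and> P d}" for m :: int
  by (rule finite_subset[of _ "{0..m}"]) (auto dest: zdvd_imp_le)

section \<open>Parity of the number of selected divisors\<close>

text \<open>For a divisor \<open>g\<close> of \<open>u\<close>, the predicate selects both or
  neither of \<open>g\<close> and \<open>p * g\<close>.\<close>

lemma even_card_divisors_paired:
  fixes p u :: int
  assumes "prime p" and "\<not> p dvd u" and "0 < u"
  shows "even (card {d. 0 < d \<and> d dvd p * u \<and> (if p dvd d then P (d div p) else P d)})"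
proof -
  have p: "1 < p" using assms(1) by (rule prime_gt_1_int)
  let ?D = "{d. 0 < d \<and> d dvd p * u \<and> (if p dvd d then P (d div p) else P d)}"
  let ?f = "\<lambda>d. if p dvd d then d div p else p * d"
  have fin: "finite ?D"
    using p assms(3) by (intro finite_positive_divisors) simp
  have f: "?f d \<in> ?D \<and> ?f (?f d) = d \<and> ?f d \<noteq> d" if d: "d \<in> ?D" for d
  proof (cases "p dvd d")
    case True
    then obtain g where g: "d = p * g" by (elim dvdE)
    then have "0 < g" "g dvd u" using d p by (auto simp: zero_less_mult_iff)
    moreover from this have "\<not> p dvd g" using assms(2) dvd_trans by blast
    ultimately show ?thesis using d g p by auto
  next
    case False
    then have "coprime p d" using assms(1) by (simp add: prime_imp_coprime)
    then have "d dvd u" using d by (simp add: coprime_commute coprime_dvd_mult_right_iff)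
    then show ?thesis using d False p by auto
  qed
  show ?thesis
    by (rule even_card_fixpoint_free[OF fin f[THEN conjunct1] f[THEN conjunct2, THEN conjunct1]
          f[THEN conjunct2, THEN conjunct2]])
qed

text \<open>For each divisor \<open>g\<close> of \<open>u\<close>, exactly one of \<open>g\<close>
  and \<open>p * g\<close> is selected. The count is therefore the number of divisors of the
  nonsquare \<open>u\<close>.\<close>

lemma even_card_divisors_exclusive:
  fixes p u :: int
  assumes "prime p" and "\<not> p dvd u" and "0 < u" and nsq: "\<nexists>s. u = s\<^sup>2"
  shows "even (card {d. 0 < d \<and> d dvd p * u \<and> (if p dvd d then \<not> P (d div p) else P d)})"
proof -
  have p: "1 < p" using assms(1) by (rule prime_gt_1_int)
  let ?D = "{d. 0 < d \<and> d dvd p * u \<and> (if p dvd d then \<not> P (d div p) else P d)}"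
  let ?U = "{g. 0 < g \<and> g dvd u}"
  let ?f = "\<lambda>d. if p dvd d then d div p else d"
  let ?f' = "\<lambda>g. if P g then g else p * g"
  have np: "\<not> p dvd g" if "g dvd u" for g using that assms(2) dvd_trans by blast
  have 1: "?f d \<in> ?U \<and> ?f' (?f d) = d" if d: "d \<in> ?D" for d
  proof (cases "p dvd d")
    case True
    then obtain g where g: "d = p * g" by (elim dvdE)
    then have "0 < g" "g dvd u" using d p by (auto simp: zero_less_mult_iff)
    then show ?thesis using d g p by auto
  next
    case False
    then have "coprime p d" using assms(1) by (simp add: prime_imp_coprime)
    then have "d dvd u" using d by (simp add: coprime_commute coprime_dvd_mult_right_iff)
    then show ?thesis using d False p by auto
  qed
  have 2: "?f' g \<in> ?D \<and> ?f (?f' g) = g" if g: "g \<in> ?U" for g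
    using g np[of g] p by auto
  have "bij_betw ?f ?D ?U"
  proof (rule bij_betw_byWitness[where f' = ?f'])
    show "\<forall>d\<in>?D. ?f' (?f d) = d" by (intro ballI 1[THEN conjunct2])
    show "\<forall>g\<in>?U. ?f (?f' g) = g" by (intro ballI 2[THEN conjunct2])
    show "?f ` ?D \<subseteq> ?U" by (intro image_subsetI 1[THEN conjunct1])
    show "?f' ` ?U \<subseteq> ?D" by (intro image_subsetI 2[THEN conjunct1])
  qed
  then have "card ?D = card ?U" by (rule bij_betw_same_card)
  moreover have "even (card ?U)"
  proof (rule even_card_fixpoint_free[where f = "\<lambda>g. u div g"])
    show "finite ?U"
      using finite_positive_divisors[OF assms(3), of "\<lambda>_. True"] by simp
  next
    fix g assume "g \<in> ?U"
    then obtain c where c: "0 < g" "u = g * c" by (auto elim!: dvdE)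
    then have "0 < c" using assms(3) by (simp add: zero_less_mult_iff)
    then show "u div g \<in> ?U" "u div (u div g) = g" using c by auto
    show "u div g \<noteq> g" using c nsq by (auto simp: power2_eq_square)
  qed
  ultimately show ?thesis by simp
qed

text \<open>In the applications the predicate is a Jacobi symbol \<open>(p / \<cdot>)\<close>, extended to multiples of \<open>p\<close>; it tells the
  genus of a form from that of its negative.\<close>

lemma alternating_predicate:
  fixes p v x y h :: int
  assumes "prime p" and "\<not> p dvd v"
    and A: "\<And>x y h. odd h \<Longrightarrow> \<not> p dvd h \<Longrightarrow> x * y = \<bar>h\<^sup>2 - p * v\<bar> \<Longrightarrow> P x \<noteq> P y"
    and B: "\<And>x y h. odd h \<Longrightarrow> x * y = \<bar>p * h\<^sup>2 - v\<bar> \<Longrightarrow> R x \<noteq> P y"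
    and "odd h" and xy: "x * y = \<bar>h\<^sup>2 - p * v\<bar>"
  shows "(if p dvd x then R (x div p) else P x) \<noteq> (if p dvd y then R (y div p) else P y)"
proof (cases "p dvd h")
  case False
  have "\<not> p dvd h\<^sup>2 - p * v"
    using False assms(1) by (simp add: dvd_diff_left_iff prime_dvd_power_iff)
  then have "\<not> p dvd x * y" unfolding xy by simp
  then have "\<not> p dvd x" "\<not> p dvd y" by auto
  then show ?thesis using A[OF \<open>odd h\<close> False xy] by simp
next
  case True
  then obtain k where k: "h = p * k" by (elim dvdE)
  then have "odd k" using \<open>odd h\<close> by simp
  have p: "1 < p" using assms(1) by (rule prime_gt_1_int)
  \<comment> \<open>As \<open>p\<close> does not divide \<open>v\<close>, it divides this number
    exactly once. So exactly one of \<open>x\<close> and \<open>y\<close> carries \<open>p\<close>,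
    and cancelling it leads to the situation of \<open>B\<close>.\<close>
  have "h\<^sup>2 - p * v = p * (p * k\<^sup>2 - v)" by (simp add: k power2_eq_square algebra_simps)
  then have xy': "x * y = p * \<bar>p * k\<^sup>2 - v\<bar>" using xy p by (simp add: abs_mult)
  have nd: "\<not> p dvd \<bar>p * k\<^sup>2 - v\<bar>" using assms(2) by (simp add: dvd_diff_right_iff)
  have main: "R (x div p) \<noteq> P y \<and> \<not> p dvd y" if "p dvd x" "x * y = p * \<bar>p * k\<^sup>2 - v\<bar>" for x y
  proof -
    obtain g where g: "x = p * g" using \<open>p dvd x\<close> by (elim dvdE)
    then have gy: "g * y = \<bar>p * k\<^sup>2 - v\<bar>" using that(2) p by simp
    then have "\<not> p dvd g * y" using nd by simp
    then show ?thesis using B[OF \<open>odd k\<close> gy] g p by auto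
  qed
  have "p dvd x * y" unfolding xy' by simp
  then have "p dvd x \<or> p dvd y" using assms(1) by (simp add: prime_dvd_mult_iff)
  then show ?thesis
  proof
    assume "p dvd x"
    then show ?thesis using main[OF _ xy'] by simp
  next
    assume "p dvd y"
    moreover have "y * x = p * \<bar>p * k\<^sup>2 - v\<bar>" using xy' by (simp add: mult.commute)
    ultimately show ?thesis using main[of y x] by auto
  qed
qed

section \<open>Finite residue tables\<close>

lemma mod_in_upto: "0 < m \<Longrightarrow> x mod m \<in> set [0..m - 1]" for m x :: int
  by simp

lemma abs_diff_mod:
  "\<bar>x - y\<bar> mod m \<in> {(x mod m - y mod m) mod m, (y mod m - x mod m) mod m}" for m x y :: int
  by (simp add: abs_if mod_diff_eq)

lemma odd_square_mod_8: "odd h \<Longrightarrow> h\<^sup>2 mod 8 = 1" for h :: int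
proof -
  assume "odd h"
  then have "odd (h mod 8)" by presburger
  moreover have "\<forall>a\<in>set [0..8 - 1 :: int]. odd a \<longrightarrow> a\<^sup>2 mod 8 = 1" by code_simp
  note bspec[OF this mod_in_upto[of 8 h, OF zero_less_numeral]]
  ultimately have "(h mod 8)\<^sup>2 mod 8 = 1" by (iprover elim: impE)
  then show ?thesis by (simp add: power_mod)
qed

lemma odd_square_mult_mod: "odd h \<Longrightarrow> c * h\<^sup>2 mod (c * 4) = c" for c h :: int
proof -
  assume "odd h"
  have "H mod 8 = 1 \<Longrightarrow> H mod 4 = 1" for H :: int by presburger
  then have "h\<^sup>2 mod 4 = 1" using odd_square_mod_8[OF \<open>odd h\<close>] by blast
  then show ?thesis by (simp add: mod_mult_mult1)
qed

lemma square_add_double_square_mod: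
  "((s mod m)\<^sup>2 + 2 * (t mod m)\<^sup>2) mod m = (s\<^sup>2 + 2 * t\<^sup>2) mod m" for s t m :: int
proof -
  have "[(s mod m)\<^sup>2 + 2 * (t mod m)\<^sup>2 = s\<^sup>2 + 2 * t\<^sup>2] (mod m)"
    by (intro cong_add cong_mult cong_pow cong_refl) (simp_all add: cong_def)
  then show ?thesis by (simp add: cong_def)
qed

text \<open>The residues 1 and 7 are those with Jacobi symbol (2/d) = 1. In the second claim
  \<open>x \<noteq> y\<close> because 7 is not a square modulo 8.\<close>

lemma units_mod_8:
  fixes x y :: int
  shows "x * y mod 8 \<in> {3, 5} \<Longrightarrow> (x mod 8 \<in> {1, 7}) \<noteq> (y mod 8 \<in> {1, 7})"
    and "x * y mod 8 = 7 \<Longrightarrow> (x mod 8 \<in> {1, 7}) = (y mod 8 \<in> {1, 7}) \<and> x \<noteq> y"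
proof -
  have "\<forall>a\<in>set [0..8 - 1]. \<forall>b\<in>set [0..8 - 1 :: int].
    (a * b mod 8 \<in> {3, 5} \<longrightarrow> (a \<in> {1, 7}) \<noteq> (b \<in> {1, 7})) \<and>
    (a * b mod 8 = 7 \<longrightarrow> (a \<in> {1, 7}) = (b \<in> {1, 7}) \<and> a \<noteq> b)"
    by code_simp
  note table = this[THEN bspec, OF mod_in_upto[of 8 x, OF zero_less_numeral],
      THEN bspec, OF mod_in_upto[of 8 y, OF zero_less_numeral], unfolded mod_mult_eq]
  show "x * y mod 8 \<in> {3, 5} \<Longrightarrow> (x mod 8 \<in> {1, 7}) \<noteq> (y mod 8 \<in> {1, 7})"
    using table by (iprover elim: conjE impE)
  show "x * y mod 8 = 7 \<Longrightarrow> (x mod 8 \<in> {1, 7}) = (y mod 8 \<in> {1, 7}) \<and> x \<noteq> y"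
    using table by (metis (no_types))
qed

text \<open>The residues 1 and 11 are those with Jacobi symbol (3/d) = 1. This symbol is even, so
  the sign lost in an absolute value is harmless.\<close>

lemma units_mod_12:
  fixes x y :: int
  shows "x * y mod 12 \<in> {1, 11} \<Longrightarrow> (x mod 12 \<in> {1, 11}) = (y mod 12 \<in> {1, 11})"
    and "x * y mod 12 \<in> {5, 7} \<Longrightarrow> (x mod 12 \<in> {1, 11}) \<noteq> (y mod 12 \<in> {1, 11})"
proof -
  have "\<forall>a\<in>set [0..12 - 1]. \<forall>b\<in>set [0..12 - 1 :: int].
    (a * b mod 12 \<in> {1, 11} \<longrightarrow> (a \<in> {1, 11}) = (b \<in> {1, 11})) \<and>
    (a * b mod 12 \<in> {5, 7} \<longrightarrow> (a \<in> {1, 11}) \<noteq> (b \<in> {1, 11}))"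
    by code_simp
  note table = this[THEN bspec, OF mod_in_upto[of 12 x, OF zero_less_numeral],
      THEN bspec, OF mod_in_upto[of 12 y, OF zero_less_numeral], unfolded mod_mult_eq]
  show "x * y mod 12 \<in> {1, 11} \<Longrightarrow> (x mod 12 \<in> {1, 11}) = (y mod 12 \<in> {1, 11})"
    "x * y mod 12 \<in> {5, 7} \<Longrightarrow> (x mod 12 \<in> {1, 11}) \<noteq> (y mod 12 \<in> {1, 11})"
    using table by (iprover elim: conjE impE)+
qed

text \<open>\<open>U\<close> consists of the residues with Jacobi symbol (7/d) = 1; the six residues
  in the second claim are the remaining units.\<close>

lemma units_mod_28:
  fixes x y :: int
  defines "U \<equiv> {1, 3, 9, 19, 25, 27}"
  shows "x * y mod 28 \<in> {3, 25} \<Longrightarrow> (x mod 28 \<in> U) = (y mod 28 \<in> U)"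
    and "x * y mod 28 \<in> {5, 11, 13, 15, 17, 23} \<Longrightarrow> (x mod 28 \<in> U) \<noteq> (y mod 28 \<in> U)"
proof -
  have "\<forall>a\<in>set [0..28 - 1]. \<forall>b\<in>set [0..28 - 1 :: int].
    (a * b mod 28 \<in> {3, 25} \<longrightarrow> (a \<in> {1, 3, 9, 19, 25, 27}) = (b \<in> {1, 3, 9, 19, 25, 27})) \<and>
    (a * b mod 28 \<in> {5, 11, 13, 15, 17, 23} \<longrightarrow> (a \<in> {1, 3, 9, 19, 25, 27}) \<noteq> (b \<in> {1, 3, 9, 19, 25, 27}))"
    by code_simp
  note table = this[THEN bspec, OF mod_in_upto[of 28 x, OF zero_less_numeral],
      THEN bspec, OF mod_in_upto[of 28 y, OF zero_less_numeral], unfolded mod_mult_eq]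
  show "x * y mod 28 \<in> {3, 25} \<Longrightarrow> (x mod 28 \<in> U) = (y mod 28 \<in> U)"
    "x * y mod 28 \<in> {5, 11, 13, 15, 17, 23} \<Longrightarrow> (x mod 28 \<in> U) \<noteq> (y mod 28 \<in> U)"
    using table unfolding U_def by (iprover elim: conjE impE)+
qed

section \<open>The individual progressions\<close>

text \<open>Here \<open>Q\<close> is the symbol (2/d): \<open>h\<^sup>2 - N\<close> is 3 modulo 8,
  so its two factors have opposite symbols. As \<open>M\<close> is 7 modulo 8, the divisors
  \<open>d\<close> and \<open>M div d\<close> are distinct with equal symbols, and \<open>M\<close>
  is not of the form \<open>s\<^sup>2 + 2 t\<^sup>2\<close>.\<close>

lemma sum_sigma0_14_mod_16:
  fixes N :: nat
  assumes N: "N mod 16 = 14"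
  shows "[(\<Sum>k | 1 \<le> k \<and> real k < sqrt (real N). sigma0 (N - k\<^sup>2)) = 0] (mod 4)"
proof -
  define M where "M = N div 2"
  have M: "N = 2 * M" "M mod 8 = 7" "odd M" using N unfolding M_def by presburger+
  have M': "int M mod 8 = 7" using M(2) by presburger
  let ?Q = "\<lambda>d :: int. d mod 8 \<in> {1, 7}"
  show ?thesis
  proof (rule sum_sigma0_cong_0_mod_4[OF M(3,1), where Q = ?Q])
    fix x y h :: int assume h: "odd h" and xy: "x * y = \<bar>h\<^sup>2 - int N\<bar>"
    have "N mod 8 = 6" using mod_mod_cancel[of 8 16 N] N by simp
    then have "int N mod 8 = 6" by (metis of_nat_numeral zmod_int)
    then have "x * y mod 8 \<in> {3, 5}"
      unfolding xy using abs_diff_mod[of "h\<^sup>2" "int N" 8] odd_square_mod_8[OF h] by auto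
    then show "?Q x \<noteq> ?Q y" by (rule units_mod_8(1))
  next
    show "even (card {d. 0 < d \<and> d dvd int M \<and> ?Q d})"
    proof (rule even_card_fixpoint_free[where f = "\<lambda>d. int M div d"])
      have M0: "0 < int M" using M(3) by presburger
      show "finite {d. 0 < d \<and> d dvd int M \<and> ?Q d}"
        using M0 by (rule finite_positive_divisors)
      fix d assume d: "d \<in> {d. 0 < d \<and> d dvd int M \<and> ?Q d}"
      then obtain c where c: "int M = d * c" by (auto elim!: dvdE)
      then have c0: "0 < c" using M0 d by (simp add: zero_less_mult_iff)
      have dc: "?Q d = ?Q c \<and> d \<noteq> c" by (rule units_mod_8(2)) (use M' c in simp)
      have div: "int M div d = c" using c d by simp
      show "int M div d \<in> {d. 0 < d \<and> d dvd int M \<and> ?Q d}"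
        unfolding div using c c0 d dc by simp
      show "int M div (int M div d) = d" unfolding div using c c0 by simp
      show "int M div d \<noteq> d" unfolding div using dc by simp
    qed
  next
    have "s\<^sup>2 + 2 * t\<^sup>2 \<noteq> M" for s t :: nat
    proof
      assume "s\<^sup>2 + 2 * t\<^sup>2 = M"
      then have "(int s)\<^sup>2 + 2 * (int t)\<^sup>2 = int M"
        by (metis of_nat_add of_nat_mult of_nat_power of_nat_numeral)
      then have "((int s mod 8)\<^sup>2 + 2 * (int t mod 8)\<^sup>2) mod 8 = 7"
        using M' by (simp add: square_add_double_square_mod)
      moreover have "\<forall>a\<in>set [0..8 - 1 :: int]. \<forall>b\<in>set [0..8 - 1 :: int]. (a\<^sup>2 + 2 * b\<^sup>2) mod 8 \<noteq> 7"
        by code_simp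
      note bspec[OF bspec[OF this mod_in_upto[of 8 "int s", OF zero_less_numeral]]
          mod_in_upto[of 8 "int t", OF zero_less_numeral]]
      ultimately show False by (iprover elim: notE)
    qed
    then show "even (card {t. 0 < t \<and> (\<exists>s. s\<^sup>2 + 2 * t\<^sup>2 = M)})" by simp
  qed
qed

lemma nonsquare_int:
  fixes u :: nat
  assumes "\<nexists>s. u = s\<^sup>2"
  shows "\<nexists>s. int u = s\<^sup>2"
proof
  assume "\<exists>s. int u = s\<^sup>2"
  then obtain s where "int u = s\<^sup>2" by blast
  then have "int u = int ((nat \<bar>s\<bar>)\<^sup>2)" by simp
  then show False using assms by (metis of_nat_eq_iff)
qed

lemma sum_sigma0_6u:
  fixes u :: nat
  assumes u: "odd u" "\<not> 3 dvd u" and nsq: "\<nexists>s. u = s\<^sup>2" and N: "N = 6 * u"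
  shows "[(\<Sum>k | 1 \<le> k \<and> real k < sqrt (real N). sigma0 (N - k\<^sup>2)) = 0] (mod 4)"
proof -
  define P :: "int \<Rightarrow> bool" where "P = (\<lambda>d. d mod 12 \<in> {1, 11})"
  \<comment> \<open>The symbol (3/d) of \<open>\<bar>3 * h\<^sup>2 - 2 * u\<bar>\<close> is -1 if
    \<open>u\<close> is 5 modulo 6 and 1 if \<open>u\<close> is 1 modulo 6. \<open>R\<close> is
    chosen so that \<open>R x \<noteq> P y\<close> in both cases.\<close>
  define R where "R = (if u mod 6 = 5 then P else (\<lambda>d. \<not> P d))"
  have p3: "prime (3 :: int)" by simp
  have u': "\<not> 3 dvd int u" "0 < int u" using u by presburger+
  have v: "\<not> 3 dvd int (2 * u)" using u by presburger
  have N': "int N = 3 * int (2 * u)" using N by simp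
  have A: "P x \<noteq> P y" if h: "odd h" "\<not> 3 dvd h" and xy: "x * y = \<bar>h\<^sup>2 - 3 * int (2 * u)\<bar>" for x y h
  proof -
    have "odd (h mod 12) \<and> \<not> 3 dvd h mod 12" using h by (simp add: dvd_mod_iff)
    moreover have "\<forall>a\<in>set [0..12 - 1 :: int]. odd a \<and> \<not> 3 dvd a \<longrightarrow> a\<^sup>2 mod 12 = 1" by code_simp
    note bspec[OF this mod_in_upto[of 12 h, OF zero_less_numeral]]
    ultimately have "(h mod 12)\<^sup>2 mod 12 = 1" by (iprover elim: impE)
    then have "h\<^sup>2 mod 12 = 1" by (simp add: power_mod)
    moreover obtain j where "u = 2 * j + 1" using u(1) by (elim oddE)
    then have "3 * int (2 * u) mod 12 = 6" by simp
    ultimately have "x * y mod 12 \<in> {5, 7}"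
      unfolding xy using abs_diff_mod[of "h\<^sup>2" "3 * int (2 * u)" 12] by auto
    then show ?thesis unfolding P_def by (rule units_mod_12(2))
  qed
  have B: "R x \<noteq> P y" if h: "odd h" and xy: "x * y = \<bar>3 * h\<^sup>2 - int (2 * u)\<bar>" for x y h
  proof (cases "u mod 6 = 5")
    case True
    have "int (2 * u) mod 12 = 10" using True by presburger
    then have "x * y mod 12 \<in> {5, 7}"
      unfolding xy using abs_diff_mod[of "3 * h\<^sup>2" "int (2 * u)" 12] odd_square_mult_mod[OF h, of 3] by auto
    then have "P x \<noteq> P y" unfolding P_def by (rule units_mod_12(2))
    then show ?thesis using True by (simp add: R_def)
  next
    case False
    then have "u mod 6 = 1" using u by presburger
    then have "int (2 * u) mod 12 = 2" by presburger
    then have "x * y mod 12 \<in> {1, 11}"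
      unfolding xy using abs_diff_mod[of "3 * h\<^sup>2" "int (2 * u)" 12] odd_square_mult_mod[OF h, of 3] by auto
    then have "P x = P y" unfolding P_def by (rule units_mod_12(1))
    then show ?thesis using False by (simp add: R_def)
  qed
  show ?thesis
  proof (rule sum_sigma0_cong_0_mod_4[where M = "3 * u" and Q = "\<lambda>d. if 3 dvd d then R (d div 3) else P d"])
    show "odd (3 * u)" "N = 2 * (3 * u)" using u N by simp_all
    show "even (card {t. 0 < t \<and> (\<exists>s. s\<^sup>2 + 2 * t\<^sup>2 = 3 * u)})"
      by (rule even_card_representations[OF refl u nsq])
    show "even (card {d. 0 < d \<and> d dvd int (3 * u) \<and> (if 3 dvd d then R (d div 3) else P d)})"
    proof (cases "u mod 6 = 5")
      case True
      then have R: "R = P" by (simp add: R_def)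
      show ?thesis
        unfolding R of_nat_mult of_nat_numeral by (rule even_card_divisors_paired[OF p3 u'])
    next
      case False
      then have R: "R = (\<lambda>d. \<not> P d)" by (simp add: R_def)
      show ?thesis
        unfolding R of_nat_mult of_nat_numeral
        by (rule even_card_divisors_exclusive[OF p3 u' nonsquare_int[OF nsq]])
    qed
    fix x y h :: int assume "odd h" "x * y = \<bar>h\<^sup>2 - int N\<bar>"
    then show "(if 3 dvd x then R (x div 3) else P x) \<noteq> (if 3 dvd y then R (y div 3) else P y)"
      unfolding N' by (intro alternating_predicate[OF p3 v A B])
  qed
qed

text \<open>Modulo 28, \<open>h\<^sup>2 - 14 * u\<close> has symbol (7/d) = -1 when 7 does not
  divide \<open>h\<close>, while \<open>7 * h\<^sup>2 - 2 * u\<close> has symbol 1; hence the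
  negation on multiples of 7. Also 5 and -2 are nonresidues modulo 7: \<open>u\<close> is no square,
  and a representation of \<open>7 * u\<close> would make 49 divide \<open>7 * u\<close>.\<close>

lemma sum_sigma0_14u:
  fixes u :: nat
  assumes u: "u mod 14 = 5" and N: "N = 14 * u"
  shows "[(\<Sum>k | 1 \<le> k \<and> real k < sqrt (real N). sigma0 (N - k\<^sup>2)) = 0] (mod 4)"
proof -
  define P :: "int \<Rightarrow> bool" where "P = (\<lambda>d. d mod 28 \<in> {1, 3, 9, 19, 25, 27})"
  obtain q where q: "u = 14 * q + 5" using u by (metis mult_div_mod_eq)
  have p7: "prime (7 :: int)" by simp
  have u': "\<not> 7 dvd int u" "0 < int u" using u by presburger+
  have v: "\<not> 7 dvd int (2 * u)" using u by presburger
  have N': "int N = 7 * int (2 * u)" using N by simp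
  have nsq: "\<nexists>s. int u = s\<^sup>2"
  proof
    assume "\<exists>s. int u = s\<^sup>2"
    then obtain s where "int u = s\<^sup>2" by blast
    moreover have "int u mod 7 = 5" using u by presburger
    ultimately have "(s mod 7)\<^sup>2 mod 7 = 5" by (simp add: power_mod)
    moreover have "\<forall>a\<in>set [0..7 - 1 :: int]. a\<^sup>2 mod 7 \<noteq> 5" by code_simp
    note bspec[OF this mod_in_upto[of 7 s, OF zero_less_numeral]]
    ultimately show False by (iprover elim: notE)
  qed
  have A: "P x \<noteq> P y" if h: "odd h" "\<not> 7 dvd h" and xy: "x * y = \<bar>h\<^sup>2 - 7 * int (2 * u)\<bar>" for x y h
  proof -
    have "odd (h mod 28) \<and> \<not> 7 dvd h mod 28" using h by (simp add: dvd_mod_iff)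
    moreover have "\<forall>a\<in>set [0..28 - 1 :: int]. odd a \<and> \<not> 7 dvd a \<longrightarrow> a\<^sup>2 mod 28 \<in> {1, 9, 25}" by code_simp
    note bspec[OF this mod_in_upto[of 28 h, OF zero_less_numeral]]
    ultimately have "(h mod 28)\<^sup>2 mod 28 \<in> {1, 9, 25}" by (iprover elim: impE)
    then have "h\<^sup>2 mod 28 \<in> {1, 9, 25}" by (simp add: power_mod)
    moreover have "7 * int (2 * u) = 14 + 28 * (7 * int q + 2)" by (simp add: q)
    then have "7 * int (2 * u) mod 28 = 14" by (simp only: mod_mult_self2) simp
    ultimately have "x * y mod 28 \<in> {5, 11, 13, 15, 17, 23}"
      unfolding xy using abs_diff_mod[of "h\<^sup>2" "7 * int (2 * u)" 28] by auto
    then show ?thesis unfolding P_def by (rule units_mod_28(2))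
  qed
  have B: "(\<not> P x) \<noteq> P y" if h: "odd h" and xy: "x * y = \<bar>7 * h\<^sup>2 - int (2 * u)\<bar>" for x y h
  proof -
    have "int (2 * u) = 10 + 28 * int q" by (simp add: q)
    then have "int (2 * u) mod 28 = 10" by (simp only: mod_mult_self2) simp
    then have "x * y mod 28 \<in> {3, 25}"
      unfolding xy using abs_diff_mod[of "7 * h\<^sup>2" "int (2 * u)" 28] odd_square_mult_mod[OF h, of 7] by auto
    then have "P x = P y" unfolding P_def by (rule units_mod_28(1))
    then show ?thesis by simp
  qed
  show ?thesis
  proof (rule sum_sigma0_cong_0_mod_4[where M = "7 * u" and Q = "\<lambda>d. if 7 dvd d then \<not> P (d div 7) else P d"])
    show "odd (7 * u)" "N = 2 * (7 * u)" using N by (simp_all add: q)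
    have "s\<^sup>2 + 2 * t\<^sup>2 \<noteq> 7 * u" for s t :: nat
    proof
      assume "s\<^sup>2 + 2 * t\<^sup>2 = 7 * u"
      then have eq: "(int s)\<^sup>2 + 2 * (int t)\<^sup>2 = 7 * int u"
        by (metis of_nat_add of_nat_mult of_nat_power of_nat_numeral)
      then have "((int s mod 7)\<^sup>2 + 2 * (int t mod 7)\<^sup>2) mod 7 = 0"
        by (simp add: square_add_double_square_mod)
      moreover have "\<forall>a\<in>set [0..7 - 1 :: int]. \<forall>b\<in>set [0..7 - 1 :: int].
          (a\<^sup>2 + 2 * b\<^sup>2) mod 7 = 0 \<longrightarrow> a = 0 \<and> b = 0"
        by code_simp
      note bspec[OF bspec[OF this mod_in_upto[of 7 "int s", OF zero_less_numeral]]
          mod_in_upto[of 7 "int t", OF zero_less_numeral]]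
      ultimately have "int s mod 7 = 0 \<and> int t mod 7 = 0" by (iprover elim: impE)
      then obtain a b where "int s = 7 * a" "int t = 7 * b" by (auto elim!: dvdE simp: mod_eq_0_iff_dvd)
      then have "7 * (7 * (a\<^sup>2 + 2 * b\<^sup>2)) = 7 * int u" using eq by (simp add: power_mult_distrib)
      then have "int u = 7 * (a\<^sup>2 + 2 * b\<^sup>2)" by simp
      then show False using u'(1) by simp
    qed
    then show "even (card {t. 0 < t \<and> (\<exists>s. s\<^sup>2 + 2 * t\<^sup>2 = 7 * u)})" by simp
    show "even (card {d. 0 < d \<and> d dvd int (7 * u) \<and> (if 7 dvd d then \<not> P (d div 7) else P d)})"
      unfolding of_nat_mult of_nat_numeral by (rule even_card_divisors_exclusive[OF p7 u' nsq])
    fix x y h :: int assume "odd h" "x * y = \<bar>h\<^sup>2 - int N\<bar>"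
    then show "(if 7 dvd x then \<not> P (x div 7) else P x) \<noteq> (if 7 dvd y then \<not> P (y div 7) else P y)"
      unfolding N' by (intro alternating_predicate[OF p7 v A B])
  qed
qed

lemma nonsquare_of_mod:
  fixes u m :: nat
  assumes "\<forall>a\<in>set [0..<m]. a\<^sup>2 mod m \<noteq> u mod m" and "0 < m"
  shows "\<nexists>s. u = s\<^sup>2"
proof
  assume "\<exists>s. u = s\<^sup>2"
  then obtain s where "u = s\<^sup>2" by blast
  then have "(s mod m)\<^sup>2 mod m = u mod m" by (simp add: power_mod)
  then show False using assms by auto
qed

theorem theorem1p1:
  fixes A B n N :: nat
  assumes "(A, B) \<in> {(16, 14), (36, 30), (72, 42), (196, 70), (252, 114)}"
    and "N = A * n + B"
  shows "[(\<Sum>k | 1 \<le> k \<and> real k < sqrt (real N). sigma0 (N - k\<^sup>2)) = 0] (mod 4)"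
proof -
  have "A = 16 \<and> B = 14 \<or> A = 36 \<and> B = 30 \<or> A = 72 \<and> B = 42 \<or> A = 196 \<and> B = 70 \<or> A = 252 \<and> B = 114"
    using assms(1) by simp
  then show ?thesis
  proof (elim disjE conjE)
    assume "A = 16" "B = 14"
    then have "N mod 16 = 14" using assms(2) by simp
    then show ?thesis by (rule sum_sigma0_14_mod_16)
  next
    \<comment> \<open>In the three progressions divisible by 6 the cofactor is 2 modulo 3, 3 modulo
      4 or 5 modulo 7, none of them a square residue. It is 5 modulo 6 in this case and 1 modulo 6
      in the other two.\<close>
    assume "A = 36" "B = 30"
    then have N: "N = 6 * (6 * n + 5)" using assms(2) by simp
    have "(6 * n + 5) mod 3 = 2" by presburger
    then have nsq: "\<nexists>s. 6 * n + 5 = s\<^sup>2"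
      by (intro nonsquare_of_mod[of 3]) (simp_all only:, code_simp+)
    have "odd (6 * n + 5)" "\<not> 3 dvd 6 * n + 5" by presburger+
    then show ?thesis using nsq N by (rule sum_sigma0_6u)
  next
    assume "A = 72" "B = 42"
    then have N: "N = 6 * (12 * n + 7)" using assms(2) by simp
    have "(12 * n + 7) mod 4 = 3" by presburger
    then have nsq: "\<nexists>s. 12 * n + 7 = s\<^sup>2"
      by (intro nonsquare_of_mod[of 4]) (simp_all only:, code_simp+)
    have "odd (12 * n + 7)" "\<not> 3 dvd 12 * n + 7" by presburger+
    then show ?thesis using nsq N by (rule sum_sigma0_6u)
  next
    assume "A = 196" "B = 70"
    then have N: "N = 14 * (14 * n + 5)" using assms(2) by simp
    have "(14 * n + 5) mod 14 = 5" by presburger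
    then show ?thesis by (rule sum_sigma0_14u[OF _ N])
  next
    assume "A = 252" "B = 114"
    then have N: "N = 6 * (42 * n + 19)" using assms(2) by simp
    have "(42 * n + 19) mod 7 = 5" by presburger
    then have nsq: "\<nexists>s. 42 * n + 19 = s\<^sup>2"
      by (intro nonsquare_of_mod[of 7]) (simp_all only:, code_simp+)
    have "odd (42 * n + 19)" "\<not> 3 dvd 42 * n + 19" by presburger+
    then show ?thesis using nsq N by (rule sum_sigma0_6u)
  qed
qed

end
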